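(* Let $X$ be a countable simplicial quasi-tree, and endow its vertex set $X^{(0)}$ with the edge-path distance and a base point $o\in X^{(0)}$. Then the Lipschitz free space $\mathcal{F}(X^{(0)})$ is isomorphic, as a Banach space, to $\ell^1$; that is, there is a bounded bijective linear map $\mathcal{F}(X^{(0)})\to\ell^1$.
   Context: A map $g:X\to Y$ between metric spaces is a quasi-isometric embedding if there is $A\geq 1$ with $\frac1A d_X(x_1,x_2)-A\leq d_Y(g(x_1),g(x_2))\leq A d_X(x_1,x_2)+A$ for all $x_1,x_2\in X$. It is a quasi-isometry if moreover there is $C>0$ such that every ball of radius $C$ in $Y$ intersects $g(X)$. A tree is a connected graph without cycles. A metric space is a quasi-tree if it is quasi-isometric to a tree (with its edge-path distance). A simplicial quasi-tree is a connected graph (not necessarily locally finite) which is a quasi-tree for its edge-path distance; it is countable if its vertex set $X^{(0)}$ is countable. The edge-path distance on $X^{(0)}$ is the minimal length of a path joining two vertices. For a pointed metric space $(X,d,o)$, $\operatorname{Lip}_o(X)$ is the Banach space of Lipschitz functions $f:X\to\mathbb{R}$ with $f(o)=0$, with norm $\operatorname{Lip}(f)$ equal to the best Lipschitz constant of $f$. For $x\in X$, $\delta_x\in\operatorname{Lip}_o(X)^*$ is the evaluation $\langle\delta_x,f\rangle=f(x)$. The Lipschitz free space $\mathcal{F}(X)$ is the closed linear span of $\{\delta_x : x\in X\}$ in $\operatorname{Lip}_o(X)^*$. $\ell^1$ is the Banach space of absolutely summable real sequences.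
   Formalization: The vertex set is assumed to be countably infinite: for a finite graph (e.g. a single vertex) the Lipschitz free space is finite-dimensional, hence not isomorphic to ℓ¹, so the claim fails there. *)

theory Defs
  imports "HOL-Analysis.Analysis" "HOL-Library.Function_Algebras"
begin

section \<open>Graphs and quasi-trees\<close>

text \<open>A graph is a pair of a vertex set and a set of edges, an edge being a set of two distinct
  vertices. A walk is the nonempty list of the vertices it visits; its length as a walk, i.e. its
  number of edges, is one less than the length of that list.\<close>

definition simple_graph :: "'a set \<Rightarrow> 'a set set \<Rightarrow> bool" where
  "simple_graph V E \<longleftrightarrow> (\<forall>e\<in>E. e \<subseteq> V \<and> card e = 2)"

definition walk :: "'a set \<Rightarrow> 'a set set \<Rightarrow> 'a list \<Rightarrow> bool" where
  "walk V E p \<longleftrightarrow> p \<noteq> [] \<and> set p \<subseteq> V \<and> successively (\<lambda>u v. {u, v} \<in> E) p"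

definition walk_betw :: "'a set \<Rightarrow> 'a set set \<Rightarrow> 'a \<Rightarrow> 'a list \<Rightarrow> 'a \<Rightarrow> bool" where
  "walk_betw V E u p v \<longleftrightarrow> walk V E p \<and> hd p = u \<and> last p = v"

definition connected_graph :: "'a set \<Rightarrow> 'a set set \<Rightarrow> bool" where
  "connected_graph V E \<longleftrightarrow> simple_graph V E \<and> (\<forall>u\<in>V. \<forall>v\<in>V. \<exists>p. walk_betw V E u p v)"

definition is_cycle :: "'a set \<Rightarrow> 'a set set \<Rightarrow> 'a list \<Rightarrow> bool" where
  "is_cycle V E p \<longleftrightarrow> walk V E p \<and> distinct p \<and> length p \<ge> 3 \<and> {last p, hd p} \<in> E"

definition is_tree :: "'a set \<Rightarrow> 'a set set \<Rightarrow> bool" where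
  "is_tree V E \<longleftrightarrow> connected_graph V E \<and> (\<nexists>p. is_cycle V E p)"

definition edge_dist :: "'a set \<Rightarrow> 'a set set \<Rightarrow> 'a \<Rightarrow> 'a \<Rightarrow> real" where
  "edge_dist V E u v = real (LEAST n. \<exists>p. walk_betw V E u p v \<and> n = length p - 1)"

text \<open>The vertex set with its edge-path distance. This is meaningful for connected graphs only,
  see \<open>mspace_graph_metric\<close> and \<open>mdist_graph_metric\<close> below.\<close>

definition graph_metric :: "'a set \<Rightarrow> 'a set set \<Rightarrow> 'a metric" where
  "graph_metric V E = metric (V, edge_dist V E)"

definition quasi_isometric_embedding :: "'a metric \<Rightarrow> 'b metric \<Rightarrow> ('a \<Rightarrow> 'b) \<Rightarrow> bool" where
  "quasi_isometric_embedding X Y g \<longleftrightarrow>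
     g \<in> mspace X \<rightarrow> mspace Y \<and>
     (\<exists>A\<ge>1. \<forall>x1\<in>mspace X. \<forall>x2\<in>mspace X.
        1 / A * mdist X x1 x2 - A \<le> mdist Y (g x1) (g x2) \<and>
        mdist Y (g x1) (g x2) \<le> A * mdist X x1 x2 + A)"

definition quasi_isometry :: "'a metric \<Rightarrow> 'b metric \<Rightarrow> ('a \<Rightarrow> 'b) \<Rightarrow> bool" where
  "quasi_isometry X Y g \<longleftrightarrow>
     quasi_isometric_embedding X Y g \<and>
     (\<exists>C>0. \<forall>y\<in>mspace Y. \<exists>x\<in>mspace X. mdist Y y (g x) < C)"

text \<open>HOL cannot quantify over types inside a formula, so the type of the vertices of the tree is
  a parameter. A theorem assuming \<open>quasi_tree TYPE('b) X\<close> with \<open>'b\<close> a type variable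
  covers trees over every type.\<close>

definition quasi_tree :: "'b itself \<Rightarrow> 'a metric \<Rightarrow> bool" where
  "quasi_tree _ X \<longleftrightarrow>
     (\<exists>(W :: 'b set) F g. is_tree W F \<and> quasi_isometry X (graph_metric W F) g)"

definition simplicial_quasi_tree :: "'b itself \<Rightarrow> 'a set \<Rightarrow> 'a set set \<Rightarrow> bool" where
  "simplicial_quasi_tree T V E \<longleftrightarrow> connected_graph V E \<and> quasi_tree T (graph_metric V E)"


subsection \<open>The edge-path distance of a connected graph is a metric\<close>

lemma edge_dist_le:
  assumes "walk_betw V E u p v"
  shows "edge_dist V E u v \<le> real (length p - 1)"
  unfolding edge_dist_def of_nat_le_iff by (rule Least_le) (use assms in blast)

lemma edge_dist_attained:
  assumes "connected_graph V E" "u \<in> V" "v \<in> V"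
  obtains p where "walk_betw V E u p v" "edge_dist V E u v = real (length p - 1)"
proof -
  from assms have "\<exists>n p. walk_betw V E u p v \<and> n = length p - 1"
    by (auto simp: connected_graph_def)
  from LeastI_ex[OF this] show ?thesis
    using that by (auto simp: edge_dist_def)
qed

lemma walk_betw_rev: "walk_betw V E u p v \<Longrightarrow> walk_betw V E v (rev p) u"
  by (auto simp: walk_betw_def walk_def hd_rev last_rev insert_commute)

lemma walk_betw_trans:
  assumes "walk_betw V E u p v" "walk_betw V E v q w"
  shows "walk_betw V E u (p @ tl q) w"
proof (cases q)
  case Nil
  then show ?thesis using assms by (simp add: walk_betw_def walk_def)
next
  case (Cons a q')
  then show ?thesis using assms
    by (cases "q' = []")
       (auto simp: walk_betw_def walk_def successively_append_iff successively_Cons)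
qed

lemma edge_dist_commute_le:
  assumes "connected_graph V E" "u \<in> V" "v \<in> V"
  shows "edge_dist V E u v \<le> edge_dist V E v u"
proof -
  obtain p where "walk_betw V E v p u" "edge_dist V E v u = real (length p - 1)"
    using edge_dist_attained assms by metis
  then show ?thesis using edge_dist_le[OF walk_betw_rev] by fastforce
qed

lemma Metric_space_edge_dist:
  assumes G: "connected_graph V E"
  shows "Metric_space V (edge_dist V E)"
proof
  show "0 \<le> edge_dist V E u v" for u v by (simp add: edge_dist_def)
  show "edge_dist V E u v = edge_dist V E v u" for u v
  proof -
    have "walk_betw V E u p v \<Longrightarrow> u \<in> V \<and> v \<in> V" for u v p
      by (auto simp: walk_betw_def walk_def)
    then have "edge_dist V E u v = edge_dist V E v u" if "\<not> (u \<in> V \<and> v \<in> V)"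
      using that unfolding edge_dist_def by (metis (no_types, lifting))
    then show ?thesis using edge_dist_commute_le[OF G] by (meson order_antisym)
  qed
  show "edge_dist V E u v = 0 \<longleftrightarrow> u = v" if "u \<in> V" "v \<in> V" for u v
  proof
    assume "edge_dist V E u v = 0"
    with edge_dist_attained[OF G that] obtain p
      where p: "walk_betw V E u p v" "length p - 1 = 0"
      by (metis of_nat_eq_0_iff)
    then show "u = v" by (cases p) (auto simp: walk_betw_def walk_def)
  next
    assume "u = v"
    then have "walk_betw V E u [u] v" using that by (simp add: walk_betw_def walk_def)
    from edge_dist_le[OF this] show "edge_dist V E u v = 0"
      by (simp add: edge_dist_def)
  qed
  show "edge_dist V E u w \<le> edge_dist V E u v + edge_dist V E v w"
    if "u \<in> V" "v \<in> V" "w \<in> V" for u v w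
  proof -
    obtain p where p: "walk_betw V E u p v" "edge_dist V E u v = real (length p - 1)"
      by (rule edge_dist_attained[OF G \<open>u \<in> V\<close> \<open>v \<in> V\<close>])
    obtain q where q: "walk_betw V E v q w" "edge_dist V E v w = real (length q - 1)"
      by (rule edge_dist_attained[OF G \<open>v \<in> V\<close> \<open>w \<in> V\<close>])
    have "p \<noteq> []" "q \<noteq> []" using p q by (auto simp: walk_betw_def walk_def)
    then have "length (p @ tl q) - 1 = (length p - 1) + (length q - 1)"
      by (cases p; cases q) auto
    then show ?thesis
      using edge_dist_le[OF walk_betw_trans[OF p(1) q(1)]] p q by simp
  qed
qed

lemma mspace_graph_metric:
  "connected_graph V E \<Longrightarrow> mspace (graph_metric V E) = V"
  by (simp add: graph_metric_def Metric_space.mspace_metric Metric_space_edge_dist)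

lemma mdist_graph_metric:
  "connected_graph V E \<Longrightarrow> mdist (graph_metric V E) = edge_dist V E"
  by (simp add: graph_metric_def Metric_space.mdist_metric Metric_space_edge_dist)


section \<open>Normed spaces of real functions\<close>

text \<open>All Banach spaces below are sets \<open>S\<close> of real-valued functions with pointwise
  operations and a norm \<open>N\<close>.\<close>

definition fscale :: "real \<Rightarrow> ('i \<Rightarrow> real) \<Rightarrow> 'i \<Rightarrow> real" where
  "fscale c f = (\<lambda>x. c * f x)"

interpretation fscale: vector_space fscale
  by standard (auto simp: fscale_def fun_eq_iff algebra_simps)

text \<open>A functional on \<open>S\<close> is represented by the function that agrees with it on \<open>S\<close> and
  is 0 elsewhere, so that equal functionals are equal as HOL functions.\<close>

definition dual_space ::
    "('i \<Rightarrow> real) set \<Rightarrow> (('i \<Rightarrow> real) \<Rightarrow> real) \<Rightarrow> (('i \<Rightarrow> real) \<Rightarrow> real) set" where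
  "dual_space S N = {\<phi>.
     (\<forall>f\<in>S. \<forall>g\<in>S. \<phi> (f + g) = \<phi> f + \<phi> g) \<and>
     (\<forall>c. \<forall>f\<in>S. \<phi> (fscale c f) = c * \<phi> f) \<and>
     (\<exists>C. \<forall>f\<in>S. \<bar>\<phi> f\<bar> \<le> C * N f) \<and>
     (\<forall>f. f \<notin> S \<longrightarrow> \<phi> f = 0)}"

definition dual_norm ::
    "('i \<Rightarrow> real) set \<Rightarrow> (('i \<Rightarrow> real) \<Rightarrow> real) \<Rightarrow> (('i \<Rightarrow> real) \<Rightarrow> real) \<Rightarrow> real" where
  "dual_norm S N \<phi> = (SUP f\<in>{f \<in> S. N f \<le> 1}. \<bar>\<phi> f\<bar>)"

text \<open>For Banach spaces the inverse of such a map is automatically bounded.\<close>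

definition banach_isomorphic ::
    "('i \<Rightarrow> real) set \<Rightarrow> (('i \<Rightarrow> real) \<Rightarrow> real) \<Rightarrow>
     ('j \<Rightarrow> real) set \<Rightarrow> (('j \<Rightarrow> real) \<Rightarrow> real) \<Rightarrow> bool" where
  "banach_isomorphic S N S' N' \<longleftrightarrow>
     (\<exists>T. bij_betw T S S' \<and>
          (\<forall>f\<in>S. \<forall>g\<in>S. T (f + g) = T f + T g) \<and>
          (\<forall>c. \<forall>f\<in>S. T (fscale c f) = fscale c (T f)) \<and>
          (\<exists>C. \<forall>f\<in>S. N' (T f) \<le> C * N f))"

definition l1 :: "(nat \<Rightarrow> real) set" where
  "l1 = {x. summable (\<lambda>n. \<bar>x n\<bar>)}"

definition l1_norm :: "(nat \<Rightarrow> real) \<Rightarrow> real" where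
  "l1_norm x = (\<Sum>n. \<bar>x n\<bar>)"


section \<open>Lipschitz functions and the Lipschitz free space\<close>

text \<open>Functions on the space are represented by functions that vanish off \<open>mspace X\<close>.\<close>

definition Lip0 :: "'a metric \<Rightarrow> 'a \<Rightarrow> ('a \<Rightarrow> real) set" where
  "Lip0 X b = {f. Lipschitz_continuous_map X euclidean_metric f \<and> f b = 0 \<and>
                  (\<forall>x. x \<notin> mspace X \<longrightarrow> f x = 0)}"

definition lip_norm :: "'a metric \<Rightarrow> ('a \<Rightarrow> real) \<Rightarrow> real" where
  "lip_norm X f = Inf {L. 0 \<le> L \<and>
     (\<forall>x\<in>mspace X. \<forall>y\<in>mspace X. \<bar>f x - f y\<bar> \<le> L * mdist X x y)}"

definition evaluation :: "'a metric \<Rightarrow> 'a \<Rightarrow> 'a \<Rightarrow> ('a \<Rightarrow> real) \<Rightarrow> real" where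
  "evaluation X b x = (\<lambda>f. if f \<in> Lip0 X b then f x else 0)"

abbreviation free_norm :: "'a metric \<Rightarrow> 'a \<Rightarrow> (('a \<Rightarrow> real) \<Rightarrow> real) \<Rightarrow> real" where
  "free_norm X b \<equiv> dual_norm (Lip0 X b) (lip_norm X)"

definition free_space :: "'a metric \<Rightarrow> 'a \<Rightarrow> (('a \<Rightarrow> real) \<Rightarrow> real) set" where
  "free_space X b = {\<phi> \<in> dual_space (Lip0 X b) (lip_norm X).
     \<forall>\<epsilon>>0. \<exists>\<psi> \<in> fscale.span (evaluation X b ` mspace X). free_norm X b (\<phi> - \<psi>) < \<epsilon>}"

end

theory Submission
  imports Defs
begin

text \<open>Cut the quasi-tree at every level: two vertices at distance \<open>n\<close> from \<open>b\<close> lie in one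
  cluster if they are joined by a walk that stays outside the open ball of radius \<open>n\<close> about
  \<open>b\<close>. A quasi-isometric embedding into a tree shows that clusters have uniformly bounded
  diameter. The clusters form a tree, and choosing a representative in each of them (the parent of
  the other members, its own parent being the representative of the cluster one level down) turns
  the vertex set itself into a rooted tree whose distance is bi-Lipschitz equivalent to the
  edge-path distance. As for the vertex set of any tree, the free space is then \<open>\<ell>\<^sup>1\<close> of the
  edges: the functional \<open>\<delta>(v) - \<delta>(p v)\<close>, with \<open>p v\<close> the parent of \<open>v\<close>, corresponds to a unit
  vector, and the coordinates of a functional are its values at the indicator functions of the sets
  of descendants.\<close>

section \<open>Separation in trees\<close>

text \<open>Connectivity inside a vertex set: the same relation serves for a tree with a point
  removed, for a graph with a ball about the root removed, and for the vertices of a single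
  walk.\<close>

definition reach :: "'a set set \<Rightarrow> 'a set \<Rightarrow> ('a \<times> 'a) set" where
  "reach E A = {(x, y). x \<in> A \<and> y \<in> A \<and> {x, y} \<in> E}\<^sup>*"

lemma reach_refl [simp]: "(x, x) \<in> reach E A"
  by (simp add: reach_def)

lemma reach_edge: "x \<in> A \<Longrightarrow> y \<in> A \<Longrightarrow> {x, y} \<in> E \<Longrightarrow> (x, y) \<in> reach E A"
  by (auto simp: reach_def)

lemma reach_trans: "(x, y) \<in> reach E A \<Longrightarrow> (y, z) \<in> reach E A \<Longrightarrow> (x, z) \<in> reach E A"
  unfolding reach_def by (rule rtrancl_trans)

lemma reach_sym: "(x, y) \<in> reach E A \<Longrightarrow> (y, x) \<in> reach E A"
proof -
  have "sym {(x, y). x \<in> A \<and> y \<in> A \<and> {x, y} \<in> E}"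
    by (auto simp: sym_def insert_commute)
  then show "(x, y) \<in> reach E A \<Longrightarrow> (y, x) \<in> reach E A"
    unfolding reach_def by (meson sym_rtrancl symD)
qed

lemma reach_mono: "A \<subseteq> B \<Longrightarrow> reach E A \<subseteq> reach E B"
  unfolding reach_def by (rule rtrancl_mono) auto

lemma reach_in:
  assumes "(x, y) \<in> reach E A" "x \<in> A"
  shows "y \<in> A"
  using assms unfolding reach_def by (induction rule: rtrancl_induct) auto

lemma walk_betw_ne: "walk_betw V E u p v \<Longrightarrow> p \<noteq> [] \<and> u \<in> set p \<and> v \<in> set p \<and> set p \<subseteq> V"
  by (auto simp: walk_betw_def walk_def)

lemma walk_reach:
  assumes "walk V E p"
  shows "(hd p, last p) \<in> reach E (set p)"
  using assms
proof (induction p)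
  case (Cons x p)
  show ?case
  proof (cases "p = []")
    case False
    then have p: "walk V E p" "{x, hd p} \<in> E"
      using Cons.prems by (auto simp: walk_def successively_Cons)
    have "(hd p, last p) \<in> reach E (set (x # p))"
      using Cons.IH[OF p(1)] reach_mono[of "set p" "set (x # p)"] by auto
    moreover have "(x, hd p) \<in> reach E (set (x # p))"
      using p(2) False by (intro reach_edge) auto
    ultimately show ?thesis using False by (auto intro: reach_trans)
  qed simp
qed (simp add: walk_def)

lemma walk_betw_reach: "walk_betw V E u p v \<Longrightarrow> (u, v) \<in> reach E (set p)"
  using walk_reach by (auto simp: walk_betw_def)

lemma walk_append1: "walk V E (p @ q) \<Longrightarrow> p \<noteq> [] \<Longrightarrow> walk V E p"
  by (auto simp: walk_def successively_append_iff)

lemma walk_append2: "walk V E (p @ q) \<Longrightarrow> q \<noteq> [] \<Longrightarrow> walk V E q"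
  by (auto simp: walk_def successively_append_iff)

text \<open>The walk is built from its end backwards. If the vertex to be prepended already occurs
  on it, the part before that occurrence is dropped instead, which keeps the vertices
  distinct.\<close>

lemma reach_distinct_walk:
  assumes "(x, y) \<in> reach E A" "x \<in> A" "A \<subseteq> V"
  obtains p where "walk_betw V E x p y" "distinct p" "set p \<subseteq> A"
proof -
  have "\<exists>p. walk_betw V E x p y \<and> distinct p \<and> set p \<subseteq> A"
    using assms(1,2) unfolding reach_def
  proof (induction rule: converse_rtrancl_induct)
    case base
    then show ?case using assms(3) by (intro exI[of _ "[y]"]) (auto simp: walk_betw_def walk_def)
  next
    case (step x z)
    then obtain p where p: "walk_betw V E z p y" "distinct p" "set p \<subseteq> A" by auto
    show ?case
    proof (cases "x \<in> set p")
      case True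
      then obtain p1 p2 where "p = p1 @ x # p2" by (meson split_list)
      with p show ?thesis using walk_append2[of V E p1 "x # p2"]
        by (intro exI[of _ "x # p2"]) (auto simp: walk_betw_def)
    next
      case False
      with p step show ?thesis using assms(3)
        by (intro exI[of _ "x # p"])
           (auto simp: walk_betw_def walk_def successively_Cons)
    qed
  qed
  then show ?thesis using that by blast
qed

text \<open>A simple walk from \<open>x\<close> to \<open>y\<close> off \<open>m\<close> would close
  up through \<open>m\<close> to a cycle; as \<open>x \<noteq> y\<close>, this cycle has at least
  three vertices.\<close>

lemma tree_neighbours_not_reach:
  assumes T: "is_tree W F" and e: "{x, m} \<in> F" "{m, y} \<in> F" and "x \<noteq> y"
  shows "(x, y) \<notin> reach F (W - {m})"
proof
  assume r: "(x, y) \<in> reach F (W - {m})"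
  have sg: "simple_graph W F" using T by (auto simp: is_tree_def connected_graph_def)
  have "{x, m} \<subseteq> W" "card {x, m} = 2" using sg e by (auto simp: simple_graph_def)
  then have x: "x \<in> W" "x \<noteq> m" "m \<in> W" by auto
  obtain p where p: "walk_betw W F x p y" "distinct p" "set p \<subseteq> W - {m}"
    using reach_distinct_walk[OF r, of W] x by auto
  then obtain p' where p': "p = x # p'" "p' \<noteq> []"
    using \<open>x \<noteq> y\<close> by (cases p) (auto simp: walk_betw_def walk_def split: if_splits)
  have "length p' \<ge> 1" using p' by (cases p') auto
  then have "is_cycle W F (m # p)"
    using p p' x e by (auto simp: is_cycle_def walk_betw_def walk_def insert_commute)
  then show False using T by (auto simp: is_tree_def)
qed

text \<open>The cases \<open>x = m\<close> and \<open>y = m\<close> count as separation because a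
  median may coincide with one of its three points.\<close>

definition separates :: "'a set \<Rightarrow> 'a set set \<Rightarrow> 'a \<Rightarrow> 'a \<Rightarrow> 'a \<Rightarrow> bool" where
  "separates W F m x y \<longleftrightarrow> x = m \<or> y = m \<or> (x, y) \<notin> reach F (W - {m})"

text \<open>If \<open>x\<close> and \<open>y\<close> were connected off \<open>m\<close>, then going
  back along the walk to \<open>x\<close>, across to \<open>y\<close>, and back along the rest of
  the walk would connect the two neighbours of \<open>m\<close> on it off \<open>m\<close>.\<close>

lemma tree_path_separates:
  assumes T: "is_tree W F" and p: "walk_betw W F x (p @ m # q) y" "distinct (p @ m # q)"
  shows "separates W F m x y"
proof (rule ccontr)
  assume "\<not> ?thesis"
  then have *: "x \<noteq> m" "y \<noteq> m" "(x, y) \<in> reach F (W - {m})" by (auto simp: separates_def)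
  then have ne: "p \<noteq> []" "q \<noteq> []" using p by (auto simp: walk_betw_def)
  have w: "walk W F p" "walk W F q" "{last p, m} \<in> F" "{m, hd q} \<in> F"
    and h: "hd p = x" "last q = y" and s: "set p \<subseteq> W - {m}" "set q \<subseteq> W - {m}"
    using p ne by (auto simp: walk_betw_def walk_def successively_append_iff successively_Cons)
  have "(last p, x) \<in> reach F (W - {m})"
    using walk_reach[OF w(1)] reach_mono[OF s(1)] h by (auto intro: reach_sym)
  moreover have "(y, hd q) \<in> reach F (W - {m})"
    using reach_sym[OF subsetD[OF reach_mono[OF s(2)] walk_reach[OF w(2)]]] h by simp
  ultimately have "(last p, hd q) \<in> reach F (W - {m})" using *(3) by (blast intro: reach_trans)
  moreover have "last p \<noteq> hd q" using p(2) ne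
    by (metis (no_types) distinct_append disjoint_iff hd_in_set last_in_set list.set_intros(2))
  ultimately show False using tree_neighbours_not_reach[OF T w(3,4)] by blast
qed

lemma connected_distinct_walk:
  assumes "connected_graph V E" "x \<in> V" "y \<in> V"
  obtains p where "walk_betw V E x p y" "distinct p"
proof -
  obtain p where "walk_betw V E x p y" using assms by (auto simp: connected_graph_def)
  from walk_betw_reach[OF this] walk_betw_ne[OF this] that show ?thesis
    by (metis reach_distinct_walk)
qed

lemma walk_join:
  assumes "walk V E (p @ [m])" "walk V E (m # q)"
  shows "walk V E (p @ m # q)"
  using assms by (auto simp: walk_def successively_append_iff)

text \<open>The median is the last vertex of a simple walk from \<open>x\<close> to \<open>z\<close>
  that lies on a simple walk from \<open>x\<close> to \<open>y\<close>. Beyond it the first walk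
  avoids the second, so recombining the pieces at \<open>m\<close> gives simple walks through
  \<open>m\<close> for all three pairs.\<close>

lemma tree_median:
  assumes T: "is_tree W F" and "x \<in> W" "y \<in> W" "z \<in> W"
  obtains m where "m \<in> W" "separates W F m x y" "separates W F m x z" "separates W F m y z"
proof -
  have G: "connected_graph W F" using T by (simp add: is_tree_def)
  obtain p where p: "walk_betw W F x p y" "distinct p"
    using connected_distinct_walk[OF G] assms by blast
  obtain q where q: "walk_betw W F x q z" "distinct q"
    using connected_distinct_walk[OF G] assms by blast
  have "\<exists>m\<in>set q. m \<in> set p" using walk_betw_ne[OF p(1)] walk_betw_ne[OF q(1)] by auto
  then obtain q1 m q2 where q': "q = q1 @ m # q2" "m \<in> set p" "\<forall>w\<in>set q2. w \<notin> set p"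
    using split_list_last_prop[of q "\<lambda>m. m \<in> set p"] by blast
  then obtain p1 p2 where p': "p = p1 @ m # p2" by (meson split_list)
  have w1: "walk W F (p1 @ [m])" using p walk_append1[of W F "p1 @ [m]" p2]
    by (simp add: p' walk_betw_def)
  have w2: "walk W F (m # p2)" using p walk_append2[of W F p1 "m # p2"]
    by (simp add: p' walk_betw_def)
  then have w3: "walk W F (rev p2 @ [m])"
    using walk_betw_rev[of W F m "m # p2" "last (m # p2)"] by (simp add: walk_betw_def)
  have w4: "walk W F (m # q2)" using q walk_append2[of W F q1 "m # q2"]
    by (simp add: q' walk_betw_def)
  have "walk_betw W F x (p1 @ m # q2) z"
    using walk_join[OF w1 w4] p q by (cases p1) (auto simp: walk_betw_def p' q')
  moreover have "walk_betw W F y (rev p2 @ m # q2) z"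
    using walk_join[OF w3 w4] p q by (auto simp: walk_betw_def p' q' hd_append hd_rev)
  moreover have "distinct (p1 @ m # q2)" "distinct (rev p2 @ m # q2)"
    using p(2) q(2) q'(3) by (auto simp: p' q'(1))
  ultimately have "separates W F m x z" "separates W F m y z"
    using tree_path_separates[OF T] by blast+
  moreover have "separates W F m x y" using tree_path_separates[OF T] p p' by blast
  moreover have "m \<in> W" using w2 by (simp add: walk_def)
  ultimately show ?thesis using that by blast
qed

lemma shortest_walk_between:
  assumes "walk_betw V E u p v" "x \<in> set p"
  shows "edge_dist V E u x + edge_dist V E x v \<le> real (length p - 1)"
proof -
  obtain p1 p2 where p: "p = p1 @ x # p2" using assms(2) by (meson split_list)
  have "walk_betw V E u (p1 @ [x]) x" "walk_betw V E x (x # p2) v"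
    using assms(1) walk_append1[of V E "p1 @ [x]" p2] walk_append2[of V E p1 "x # p2"]
    by (cases p1; auto simp: walk_betw_def p)+
  from this[THEN edge_dist_le] show ?thesis by (auto simp: p)
qed

text \<open>Replace each step of the chain by a geodesic, of length at most \<open>C\<close>,
  between the images of its ends. If all images were farther than \<open>C\<close> from
  \<open>m\<close>, these geodesics would miss \<open>m\<close> and together connect
  \<open>g u\<close> to \<open>g v\<close> off \<open>m\<close>.\<close>

lemma coarse_walk_near_separator:
  assumes T: "connected_graph W F" and g: "\<And>x. x \<in> A \<Longrightarrow> g x \<in> W"
    and adj: "\<And>x y. x \<in> A \<Longrightarrow> y \<in> A \<Longrightarrow> {x, y} \<in> E \<Longrightarrow> edge_dist W F (g x) (g y) \<le> C"
    and "C \<ge> 0" and m: "m \<in> W" "separates W F m (g u) (g v)"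
    and r: "(u, v) \<in> reach E A" "u \<in> A"
  obtains x where "x \<in> A" "edge_dist W F (g x) m \<le> C"
proof (rule ccontr)
  assume "\<not> thesis"
  then have far: "edge_dist W F (g x) m > C" if "x \<in> A" for x
    using that \<open>\<And>x. x \<in> A \<Longrightarrow> _ \<Longrightarrow> thesis\<close> by force
  interpret T: Metric_space W "edge_dist W F" by (rule Metric_space_edge_dist[OF T])
  have ne: "g x \<noteq> m" if "x \<in> A" for x using far[OF that] \<open>C \<ge> 0\<close> m(1) by auto
  have "(g u, g v) \<in> reach F (W - {m})"
    using r(1) unfolding reach_def[of E]
  proof (induction rule: rtrancl_induct)
    case (step x y)
    then have xy: "x \<in> A" "y \<in> A" "{x, y} \<in> E" by auto
    obtain p where p: "walk_betw W F (g x) p (g y)"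
      "edge_dist W F (g x) (g y) = real (length p - 1)"
      using edge_dist_attained[OF T g[OF xy(1)] g[OF xy(2)]] by blast
    have "m \<notin> set p"
    proof
      assume "m \<in> set p"
      from shortest_walk_between[OF p(1) this] show False
        using far[OF xy(1)] adj[OF xy] p(2) T.nonneg[of m "g y"] by linarith
    qed
    then have "set p \<subseteq> W - {m}" using walk_betw_ne[OF p(1)] by auto
    then have "(g x, g y) \<in> reach F (W - {m})"
      using walk_betw_reach[OF p(1)] reach_mono by blast
    with step.IH show ?case by (rule reach_trans)
  qed simp
  moreover have "g u \<noteq> m" "g v \<noteq> m" using ne r reach_in by metis+
  ultimately show False using m(2) by (auto simp: separates_def)
qed

section \<open>The tree of clusters\<close>

text \<open>With \<open>b\<close> left out, the elements stand for the edges on the path from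
  \<open>v\<close> to the root, each named by its end farther from the root.\<close>

definition ancestors :: "('a \<Rightarrow> 'a) \<Rightarrow> 'a \<Rightarrow> 'a \<Rightarrow> 'a set" where
  "ancestors p b v = range (\<lambda>k. (p ^^ k) v) - {b}"

lemma ancestors_root: "p b = b \<Longrightarrow> ancestors p b b = {}"
proof -
  assume "p b = b"
  then have "(p ^^ k) b = b" for k by (induction k) auto
  then show ?thesis by (auto simp: ancestors_def)
qed

lemma ancestors_step: "v \<noteq> b \<Longrightarrow> ancestors p b v = insert v (ancestors p b (p v))"
proof -
  assume "v \<noteq> b"
  have "range (\<lambda>k. (p ^^ k) v) = insert v (range (\<lambda>k. (p ^^ k) (p v)))"
  proof -
    have "(p ^^ k) v \<in> insert v (range (\<lambda>k. (p ^^ k) (p v)))" for k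
      by (cases k) (auto simp: funpow_swap1)
    moreover have "(p ^^ k) (p v) = (p ^^ Suc k) v" for k by (simp add: funpow_swap1)
    moreover have "v = (p ^^ 0) v" by simp
    ultimately show ?thesis by blast
  qed
  with \<open>v \<noteq> b\<close> show ?thesis by (auto simp: ancestors_def)
qed

section \<open>Levels, clusters and their representatives\<close>

locale rooted_graph =
  fixes V :: "'a set" and E :: "'a set set" and b :: 'a
  assumes G: "connected_graph V E" and b: "b \<in> V"
begin

sublocale Metric_space V "edge_dist V E" by (rule Metric_space_edge_dist[OF G])

definition lev :: "'a \<Rightarrow> nat" where
  "lev v = nat \<lfloor>edge_dist V E b v\<rfloor>"

lemma real_lev: "real (lev v) = edge_dist V E b v"
  by (simp add: lev_def edge_dist_def)

lemma edge_in: "{u, v} \<in> E \<Longrightarrow> u \<in> V \<and> v \<in> V"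
  using G by (auto simp: connected_graph_def simple_graph_def)

lemma edge_dist_adj: "{u, v} \<in> E \<Longrightarrow> edge_dist V E u v \<le> 1"
  using edge_dist_le[of V E u "[u, v]" v] edge_in[of u v]
  by (auto simp: walk_betw_def walk_def)

lemma lev_adj:
  assumes "{u, v} \<in> E"
  shows "lev v \<le> Suc (lev u)"
proof -
  have "real (lev v) \<le> real (lev u) + 1"
    using triangle[of b u v] edge_dist_adj[OF assms] edge_in[OF assms] b unfolding real_lev by auto
  then show ?thesis by linarith
qed

lemma lev_root [simp]: "lev b = 0"
  using b real_lev[of b] by simp

lemma lev_eq_0: "v \<in> V \<Longrightarrow> lev v = 0 \<longleftrightarrow> v = b"
  using b real_lev[of v] by (metis zero of_nat_0 of_nat_eq_iff)

definition cluster :: "'a \<Rightarrow> 'a set" where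
  "cluster v = {u \<in> V. lev u = lev v \<and> (v, u) \<in> reach E {x \<in> V. lev v \<le> lev x}}"

definition rep :: "'a \<Rightarrow> 'a" where
  "rep v = (SOME u. u \<in> cluster v)"

definition down :: "'a \<Rightarrow> 'a" where
  "down v = (SOME u. {u, v} \<in> E \<and> lev v = Suc (lev u))"

definition parent :: "'a \<Rightarrow> 'a" where
  "parent v = (if v = b then b else if v = rep v then rep (down v) else rep v)"

lemma cluster_self: "v \<in> V \<Longrightarrow> v \<in> cluster v"
  by (simp add: cluster_def)

lemma cluster_eqI:
  assumes "lev u = lev v" "(v, u) \<in> reach E {x \<in> V. lev v \<le> lev x}"
  shows "cluster u = cluster v"
proof -
  have "(u, x) \<in> reach E A \<longleftrightarrow> (v, x) \<in> reach E A" if "A = {x \<in> V. lev v \<le> lev x}" for x A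
    using assms(2) reach_sym[OF assms(2)] reach_trans[of _ _ E A x] that by metis
  then show ?thesis using assms(1) by (auto simp: cluster_def)
qed

lemma rep_in: "v \<in> V \<Longrightarrow> rep v \<in> cluster v"
  unfolding rep_def using cluster_self by (metis someI_ex)

lemma rep_V: "v \<in> V \<Longrightarrow> rep v \<in> V" and lev_rep: "v \<in> V \<Longrightarrow> lev (rep v) = lev v"
  using rep_in by (auto simp: cluster_def)

lemma cluster_rep: "v \<in> V \<Longrightarrow> cluster (rep v) = cluster v"
  using rep_in[of v] by (intro cluster_eqI) (auto simp: cluster_def)

lemma rep_rep: "v \<in> V \<Longrightarrow> rep (rep v) = rep v"
  using cluster_rep unfolding rep_def by simp

lemma rep_root [simp]: "rep b = b"
  using rep_V[OF b] lev_rep[OF b] lev_eq_0 by simp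

text \<open>The last vertex but one of a geodesic from \<open>b\<close> to \<open>v\<close>
  qualifies, so the choice in \<open>down\<close> is meaningful.\<close>

lemma down:
  assumes "v \<in> V" "v \<noteq> b"
  shows "{down v, v} \<in> E" "lev v = Suc (lev (down v))"
proof -
  obtain p where p: "walk_betw V E b p v" "edge_dist V E b v = real (length p - 1)"
    using edge_dist_attained[OF G b assms(1)] by blast
  have "p \<noteq> []" "last p = v" using p by (auto simp: walk_betw_def walk_def)
  then obtain q where q: "p = q @ [v]" by (metis append_butlast_last_id)
  then have "q \<noteq> []" using p(1) assms(2) by (auto simp: walk_betw_def)
  then have w: "walk_betw V E b q (last q)" and e: "{last q, v} \<in> E"
    using p(1) by (auto simp: q walk_betw_def walk_def successively_append_iff)
  have "real (lev (last q)) \<le> real (length q - 1)"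
    using edge_dist_le[OF w] by (simp add: real_lev)
  moreover have "real (lev v) = real (length q)" using p(2) by (simp add: q real_lev)
  moreover have "length q > 0" using \<open>q \<noteq> []\<close> by simp
  ultimately have "Suc (lev (last q)) \<le> lev v" by linarith
  then have "\<exists>u. {u, v} \<in> E \<and> lev v = Suc (lev u)" using lev_adj[OF e] e by (metis le_antisym)
  from someI_ex[OF this] show "{down v, v} \<in> E" "lev v = Suc (lev (down v))"
    by (simp_all add: down_def)
qed

lemma down_V: "v \<in> V \<Longrightarrow> v \<noteq> b \<Longrightarrow> down v \<in> V"
  using down edge_in by blast

text \<open>The edges \<open>{y, v}\<close> and \<open>{x, u}\<close> extend the connection between
  \<open>v\<close> and \<open>u\<close> one level down without entering the smaller ball. Hence only
  one cluster lies directly below a given one.\<close>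

lemma cluster_below:
  assumes "u \<in> cluster v" "{x, u} \<in> E" "{y, v} \<in> E" "lev u = Suc (lev x)" "lev v = Suc (lev y)"
  shows "cluster x = cluster y"
proof (rule cluster_eqI)
  have l: "lev u = lev v" and r: "(v, u) \<in> reach E {x \<in> V. lev v \<le> lev x}"
    using assms(1) by (auto simp: cluster_def)
  show "lev x = lev y" using l assms by simp
  let ?R = "reach E {x \<in> V. lev y \<le> lev x}"
  have yv: "(y, v) \<in> ?R" and ux: "(u, x) \<in> ?R"
    using assms l edge_in[OF assms(2)] edge_in[OF assms(3)]
    by (auto intro!: reach_edge simp: insert_commute)
  have vu: "(v, u) \<in> ?R"
    by (rule subsetD[OF reach_mono r]) (use assms(5) in auto)
  show "(y, x) \<in> ?R" by (rule reach_trans[OF reach_trans[OF yv vu] ux])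
qed

section \<open>The parent map and its tree distance\<close>

lemma parent_root: "parent b = b"
  by (simp add: parent_def)

lemma parent_V: "v \<in> V \<Longrightarrow> parent v \<in> V"
  using rep_V down_V b by (auto simp: parent_def)

text \<open>The parent of a vertex that is not a representative has the same level, so the level
  alone does not decrease. Doubling it leaves room for a bit that drops in this case.\<close>

definition rank :: "'a \<Rightarrow> nat" where
  "rank v = 2 * lev v + (if v = rep v then 0 else 1)"

lemma rank_parent:
  assumes "v \<in> V" "v \<noteq> b"
  shows "rank (parent v) < rank v"
proof (cases "v = rep v")
  case True
  then show ?thesis
    using assms down[OF assms] lev_rep[OF down_V[OF assms]] rep_rep[OF down_V[OF assms]]
    by (simp add: parent_def rank_def)
next
  case False
  then show ?thesis using assms lev_rep rep_rep by (simp add: parent_def rank_def)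
qed

lemma ancestors_rep:
  assumes "v \<in> V"
  shows "ancestors parent b (rep v) \<subseteq> ancestors parent b v"
    "ancestors parent b v \<subseteq> insert v (ancestors parent b (rep v))"
proof -
  have *: "ancestors parent b v = insert v (ancestors parent b (rep v))" if "rep v \<noteq> v"
  proof -
    have "v \<noteq> b" using that by auto
    then show ?thesis using that ancestors_step[of v b parent] by (simp add: parent_def)
  qed
  then have "ancestors parent b v = ancestors parent b (rep v) \<or>
      ancestors parent b v = insert v (ancestors parent b (rep v))"
    by metis
  then show "ancestors parent b (rep v) \<subseteq> ancestors parent b v"
    "ancestors parent b v \<subseteq> insert v (ancestors parent b (rep v))"
    by blast+
qed

text \<open>Ends on the same level lie in one cluster and share a representative. Otherwise
  \<open>cluster_below\<close> shows that the parent of \<open>rep v\<close> is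
  \<open>rep u\<close>. Passing from a vertex to its representative costs at most the vertex itself,
  by \<open>ancestors_rep\<close>.\<close>

lemma ancestors_adj:
  assumes e: "{u, v} \<in> E" and le: "lev u \<le> lev v"
  shows "sym_diff (ancestors parent b u) (ancestors parent b v) \<subseteq> {u, v, rep v}"
proof -
  have V: "u \<in> V" "v \<in> V" using edge_in[OF e] by auto
  consider "lev u = lev v" | "lev v = Suc (lev u)" using lev_adj[OF e] le by linarith
  then show ?thesis
  proof cases
    case 1
    then have "cluster v = cluster u" using e V by (intro cluster_eqI reach_edge) auto
    then have "rep v = rep u" by (simp add: rep_def)
    then show ?thesis using ancestors_rep[OF V(1)] ancestors_rep[OF V(2)] by auto
  next
    case 2
    then have "rep v \<noteq> b" using lev_rep[OF V(2)] by auto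
    then have r: "{down (rep v), rep v} \<in> E" "lev (rep v) = Suc (lev (down (rep v)))"
      using down[OF rep_V[OF V(2)]] by auto
    have "cluster (down (rep v)) = cluster u"
      using cluster_below[OF rep_in[OF V(2)] r(1) e r(2) 2] .
    then have "parent (rep v) = rep u"
      using rep_rep[OF V(2)] \<open>rep v \<noteq> b\<close> by (simp add: parent_def rep_def)
    then have "ancestors parent b (rep v) = insert (rep v) (ancestors parent b (rep u))"
      using ancestors_step[OF \<open>rep v \<noteq> b\<close>] by simp
    then show ?thesis using ancestors_rep[OF V(1)] ancestors_rep[OF V(2)] by auto
  qed
qed

text \<open>Each edge changes at most three ancestors. Finiteness is carried along because
  \<open>card\<close> is 0 on infinite sets.\<close>

lemma ancestors_walk:
  assumes "walk V E p"
  shows "finite (sym_diff (ancestors parent b (hd p)) (ancestors parent b (last p))) \<and>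
    card (sym_diff (ancestors parent b (hd p)) (ancestors parent b (last p))) \<le> 3 * (length p - 1)"
  using assms
proof (induction p)
  case (Cons x p)
  let ?A = "ancestors parent b"
  show ?case
  proof (cases "p = []")
    case False
    then have p: "walk V E p" "{x, hd p} \<in> E"
      using Cons.prems by (auto simp: walk_def successively_Cons)
    \<comment> \<open>The vertex \<open>z\<close> is the representative of the end with the higher
      level, which may be either end of the edge.\<close>
    have "\<exists>z. sym_diff (?A x) (?A (hd p)) \<subseteq> {x, hd p, z}"
    proof (cases "lev x \<le> lev (hd p)")
      case True
      then show ?thesis using ancestors_adj[OF p(2)] by blast
    next
      case False
      then have "sym_diff (?A (hd p)) (?A x) \<subseteq> {hd p, x, rep x}"
        using p(2) by (intro ancestors_adj) (auto simp: insert_commute)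
      then show ?thesis by blast
    qed
    then obtain z where z: "sym_diff (?A x) (?A (hd p)) \<subseteq> {x, hd p, z}" by blast
    let ?S = "sym_diff (?A (hd p)) (?A (last p))"
    have sub: "sym_diff (?A x) (?A (last p)) \<subseteq> {x, hd p, z} \<union> ?S" using z by auto
    have fin: "finite ?S" "card ?S \<le> 3 * (length p - 1)" using Cons.IH[OF p(1)] by auto
    have "card {x, hd p, z} \<le> 3" by (simp add: card_insert_if)
    then have "card ({x, hd p, z} \<union> ?S) \<le> 3 + 3 * (length p - 1)"
      using card_Un_le[of "{x, hd p, z}" ?S] fin(2) by linarith
    moreover have "card (sym_diff (?A x) (?A (last p))) \<le> card ({x, hd p, z} \<union> ?S)"
      using fin(1) sub by (intro card_mono) auto
    moreover have "3 + 3 * (length p - 1) = 3 * (length (x # p) - 1)" using False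
      by (cases p) auto
    ultimately show ?thesis using False finite_subset[OF sub] fin(1) by auto
  qed simp
qed (simp add: walk_def)

lemma ancestors_dist:
  assumes "u \<in> V" "v \<in> V"
  shows "real (card (sym_diff (ancestors parent b u) (ancestors parent b v))) \<le> 3 * edge_dist V E u v"
proof -
  obtain p where p: "walk_betw V E u p v" "edge_dist V E u v = real (length p - 1)"
    using edge_dist_attained[OF G assms] by blast
  then show ?thesis using ancestors_walk[of p] by (auto simp: walk_betw_def)
qed

text \<open>A representative other than \<open>b\<close> reaches its parent by one edge down and
  then across a cluster; the parent of any other vertex lies in its own cluster.\<close>

lemma dist_parent:
  assumes D: "\<And>u v. u \<in> V \<Longrightarrow> v \<in> cluster u \<Longrightarrow> edge_dist V E u v \<le> D" and v: "v \<in> V"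
  shows "edge_dist V E v (parent v) \<le> D + 1"
proof -
  have "D \<ge> 0" using D[OF b cluster_self[OF b]] nonneg[of b b] by linarith
  show ?thesis
  proof (cases "v = b \<or> v \<noteq> rep v")
    case True
    then show ?thesis using \<open>D \<ge> 0\<close> D[OF v rep_in[OF v]] b by (auto simp: parent_def)
  next
    case False
    then have d: "down v \<in> V" "edge_dist V E v (down v) \<le> 1"
      using down_V[OF v] down[OF v] edge_dist_adj[of v "down v"] by (auto simp: insert_commute)
    have "edge_dist V E v (rep (down v)) \<le> 1 + D"
      using triangle[OF v d(1) rep_V[OF d(1)]] d(2) D[OF d(1) rep_in[OF d(1)]] by linarith
    then show ?thesis using False by (simp add: parent_def)
  qed
qed

text \<open>If \<open>m\<close> is the median of the images of \<open>b\<close>, \<open>u\<close> and \<open>v\<close> in the tree, then geodesics from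
  \<open>b\<close> to \<open>u\<close> and to \<open>v\<close> as well as a walk from \<open>u\<close> to \<open>v\<close> outside the ball pass
  near \<open>m\<close>. The point near \<open>m\<close> on the latter has level at least that of \<open>u\<close> and \<open>v\<close>, so
  the points near \<open>m\<close> on the geodesics are close to their ends.\<close>

lemma cluster_diameter:
  assumes T: "is_tree W F"
    and g: "quasi_isometric_embedding (graph_metric V E) (graph_metric W F) g"
  obtains D where "\<And>u v. u \<in> V \<Longrightarrow> v \<in> cluster u \<Longrightarrow> edge_dist V E u v \<le> D"
proof -
  have GT: "connected_graph W F" using T by (simp add: is_tree_def)
  interpret T: Metric_space W "edge_dist W F" by (rule Metric_space_edge_dist[OF GT])
  obtain A where A: "A \<ge> 1"
    and lo: "\<And>x y. x \<in> V \<Longrightarrow> y \<in> V \<Longrightarrow> 1 / A * edge_dist V E x y - A \<le> edge_dist W F (g x) (g y)"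
    and up: "\<And>x y. x \<in> V \<Longrightarrow> y \<in> V \<Longrightarrow> edge_dist W F (g x) (g y) \<le> A * edge_dist V E x y + A"
    and gW: "\<And>x. x \<in> V \<Longrightarrow> g x \<in> W"
    using g by (auto simp: quasi_isometric_embedding_def mspace_graph_metric[OF G]
      mspace_graph_metric[OF GT] mdist_graph_metric[OF G] mdist_graph_metric[OF GT])
  \<comment> \<open>Adjacent vertices have images at distance at most
    \<open>A * 1 + A\<close>.\<close>
  define C where "C = 2 * A"
  have C0: "C \<ge> 0" using A by (simp add: C_def)
  have adj: "edge_dist W F (g x) (g y) \<le> C" if "{x, y} \<in> E" for x y
  proof -
    have "A * edge_dist V E x y \<le> A * 1" using edge_dist_adj[OF that] A by (intro mult_left_mono) auto
    then show ?thesis using up[of x y] edge_in[OF that] unfolding C_def by linarith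
  qed
  \<comment> \<open>Images within \<open>C\<close> of \<open>m\<close> are within
    \<open>2 * C\<close> of each other; the lower bound on \<open>g\<close> turns this into
    \<open>K\<close>.\<close>
  define K where "K = A * (2 * C + A)"
  have close: "edge_dist V E x y \<le> K"
    if "x \<in> V" "y \<in> V" "m \<in> W" "edge_dist W F (g x) m \<le> C" "edge_dist W F (g y) m \<le> C" for x y m
  proof -
    have "edge_dist W F (g x) (g y) \<le> 2 * C"
      using T.triangle'[of "g x" m "g y"] that gW by auto
    then have "1 / A * edge_dist V E x y \<le> 2 * C + A" using lo[OF that(1,2)] by linarith
    then have "A * (1 / A * edge_dist V E x y) \<le> K"
      unfolding K_def using A by (intro mult_left_mono) auto
    then show ?thesis using A by simp
  qed
  \<comment> \<open>The level of \<open>x\<close> is at least that of \<open>z\<close> minus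
    \<open>K\<close>, hence at least that of \<open>u\<close> minus \<open>K\<close>. Since
    \<open>x\<close> lies on a geodesic from \<open>b\<close> to \<open>u\<close>, at most
    \<open>K\<close> remains to \<open>u\<close>.\<close>
  have near_end: "edge_dist V E x u \<le> K"
    if "walk_betw V E b p u" "edge_dist V E b u = real (length p - 1)" "x \<in> set p"
      "z \<in> V" "lev u \<le> lev z" "edge_dist V E x z \<le> K" for p x u z
  proof -
    have "x \<in> V" using that walk_betw_ne by fast
    then show ?thesis
      using shortest_walk_between[OF that(1,3)] that(2,5,6) triangle[OF b \<open>x \<in> V\<close> that(4)]
        real_lev[of u] real_lev[of z] by linarith
  qed
  \<comment> \<open>The chain \<open>u\<close>, \<open>x\<close>, \<open>z\<close>,
    \<open>y\<close>, \<open>v\<close> consists of four steps of length at most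
    \<open>K\<close>.\<close>
  have "edge_dist V E u v \<le> 4 * K" if u: "u \<in> V" and v: "v \<in> cluster u" for u v
  proof -
    have v': "v \<in> V" "lev v = lev u" "(u, v) \<in> reach E {x \<in> V. lev u \<le> lev x}"
      using v by (auto simp: cluster_def)
    obtain m where m: "m \<in> W" "separates W F m (g b) (g u)" "separates W F m (g b) (g v)"
      "separates W F m (g u) (g v)"
      using tree_median[OF T gW[OF b] gW[OF u] gW[OF v'(1)]] by blast
    obtain p where p: "walk_betw V E b p u" "edge_dist V E b u = real (length p - 1)"
      using edge_dist_attained[OF G b u] by blast
    obtain q where q: "walk_betw V E b q v" "edge_dist V E b v = real (length q - 1)"
      using edge_dist_attained[OF G b v'(1)] by blast
    note near = coarse_walk_near_separator[OF GT _ _ C0 m(1), where g = g and E = E]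
    have pV: "set p \<subseteq> V" "b \<in> set p" "set q \<subseteq> V" "b \<in> set q"
      using walk_betw_ne[OF p(1)] walk_betw_ne[OF q(1)] by auto
    obtain x where x: "x \<in> set p" "edge_dist W F (g x) m \<le> C"
      by (rule near[OF _ _ m(2) walk_betw_reach[OF p(1)]]) (use pV gW adj in auto)
    obtain y where y: "y \<in> set q" "edge_dist W F (g y) m \<le> C"
      by (rule near[OF _ _ m(3) walk_betw_reach[OF q(1)]]) (use pV gW adj in auto)
    obtain z where z: "z \<in> {x \<in> V. lev u \<le> lev x}" "edge_dist W F (g z) m \<le> C"
      by (rule near[OF _ _ m(4) v'(3)]) (use u gW adj in auto)
    have V: "x \<in> V" "y \<in> V" "z \<in> V" using x y z pV by auto
    have "edge_dist V E x z \<le> K" "edge_dist V E y z \<le> K"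
      using close[OF _ _ m(1)] V x y z by auto
    then have "edge_dist V E x u \<le> K" "edge_dist V E y v \<le> K"
      using near_end[OF p x(1) V(3)] near_end[OF q y(1) V(3)] z v' by auto
    then show ?thesis
      using \<open>edge_dist V E x z \<le> K\<close> \<open>edge_dist V E y z \<le> K\<close> triangle'[OF u V(1) V(3)]
        triangle[OF u V(1) V(3)] triangle[OF u V(3) V(2)] triangle[OF u V(2) v'(1)]
        commute[of x u] commute[of y z] by linarith
  qed
  then show ?thesis using that by blast
qed

end

section \<open>Free spaces of metrics equivalent to tree metrics\<close>

lemma sum_real_fun_apply: "(\<Sum>i\<in>A. h i) x = (\<Sum>i\<in>A. h i x :: real)"
  by (induction A rule: infinite_finite_induct) auto

lemma fscale_apply [simp]: "fscale c f x = c * f x"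
  by (simp add: fscale_def)

lemma Lip0I:
  assumes "\<And>x y. x \<in> mspace X \<Longrightarrow> y \<in> mspace X \<Longrightarrow> \<bar>f x - f y\<bar> \<le> L * mdist X x y"
    and "f b = 0" "\<And>x. x \<notin> mspace X \<Longrightarrow> f x = 0"
  shows "f \<in> Lip0 X b"
  using assms by (auto simp: Lip0_def Lipschitz_continuous_map_def dist_real_def)

lemma lip_norm_le:
  assumes "0 \<le> L" "\<And>x y. x \<in> mspace X \<Longrightarrow> y \<in> mspace X \<Longrightarrow> \<bar>f x - f y\<bar> \<le> L * mdist X x y"
  shows "lip_norm X f \<le> L"
  unfolding lip_norm_def by (rule cInf_lower) (use assms in \<open>auto intro!: bdd_belowI[of _ 0]\<close>)

lemma Lip0_constants_nonempty:
  assumes "f \<in> Lip0 X b"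
  shows "{L. 0 \<le> L \<and> (\<forall>x\<in>mspace X. \<forall>y\<in>mspace X. \<bar>f x - f y\<bar> \<le> L * mdist X x y)} \<noteq> {}"
proof -
  obtain B where "B > 0" "\<forall>x\<in>mspace X. \<forall>y\<in>mspace X. \<bar>f x - f y\<bar> \<le> B * mdist X x y"
    using assms by (auto simp: Lip0_def Lipschitz_continuous_map_pos dist_real_def)
  then show ?thesis using less_imp_le by blast
qed

lemma lip_norm_nonneg: "f \<in> Lip0 X b \<Longrightarrow> 0 \<le> lip_norm X f"
  unfolding lip_norm_def by (rule cInf_greatest[OF Lip0_constants_nonempty]) auto

text \<open>The infimum is itself a Lipschitz constant: each difference quotient is a lower bound of
  the admissible constants.\<close>

lemma lip_norm_bound:
  assumes f: "f \<in> Lip0 X b" and x: "x \<in> mspace X" and y: "y \<in> mspace X"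
  shows "\<bar>f x - f y\<bar> \<le> lip_norm X f * mdist X x y"
proof (cases "x = y")
  case True
  moreover have "mdist X x x = 0" using x by simp
  ultimately show ?thesis by (simp only: diff_self abs_zero mult_zero_right order_refl)
next
  case False
  then have "mdist X x y \<noteq> 0" using x y by simp
  then have d: "mdist X x y > 0" using mdist_nonneg[of X x y] by linarith
  have "\<bar>f x - f y\<bar> / mdist X x y \<le> lip_norm X f"
    unfolding lip_norm_def
    by (rule cInf_greatest[OF Lip0_constants_nonempty[OF f]])
       (use x y d in \<open>auto simp: divide_le_eq\<close>)
  then show ?thesis using d by (simp add: divide_le_eq)
qed

lemma Lip0_zero: "0 \<in> Lip0 X b"
  by (rule Lip0I[of _ _ 0]) auto

lemma Lip0_add:
  assumes "f \<in> Lip0 X b" "g \<in> Lip0 X b"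
  shows "f + g \<in> Lip0 X b"
proof (rule Lip0I[of _ _ "lip_norm X f + lip_norm X g"])
  show "\<bar>(f + g) x - (f + g) y\<bar> \<le> (lip_norm X f + lip_norm X g) * mdist X x y"
    if "x \<in> mspace X" "y \<in> mspace X" for x y
    using lip_norm_bound[OF assms(1) that] lip_norm_bound[OF assms(2) that]
    by (auto simp: algebra_simps)
qed (use assms in \<open>auto simp: Lip0_def\<close>)

lemma lip_norm_bound_scale:
  assumes "f \<in> Lip0 X b" "x \<in> mspace X" "y \<in> mspace X"
  shows "\<bar>fscale c f x - fscale c f y\<bar> \<le> (\<bar>c\<bar> * lip_norm X f) * mdist X x y"
proof -
  have "\<bar>fscale c f x - fscale c f y\<bar> = \<bar>c\<bar> * \<bar>f x - f y\<bar>"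
    by (simp flip: right_diff_distrib abs_mult)
  then show ?thesis using mult_left_mono[OF lip_norm_bound[OF assms], of "\<bar>c\<bar>"]
    by (simp add: mult.assoc)
qed

lemma Lip0_scale: "f \<in> Lip0 X b \<Longrightarrow> fscale c f \<in> Lip0 X b"
  by (rule Lip0I[OF lip_norm_bound_scale]) (auto simp: Lip0_def)

lemma Lip0_sum: "(\<And>i. i \<in> A \<Longrightarrow> h i \<in> Lip0 X b) \<Longrightarrow> (\<Sum>i\<in>A. h i) \<in> Lip0 X b"
  by (induction A rule: infinite_finite_induct) (auto intro: Lip0_zero Lip0_add)

section \<open>Bounded functionals and the dual norm\<close>

lemma subspace_dual_space: "fscale.subspace (dual_space S N)"
proof (rule fscale.subspaceI)
  show "0 \<in> dual_space S N" by (auto simp: dual_space_def intro!: exI[of _ 0])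
  show "\<phi> + \<psi> \<in> dual_space S N" if \<phi>: "\<phi> \<in> dual_space S N" and \<psi>: "\<psi> \<in> dual_space S N" for \<phi> \<psi>
  proof -
    obtain C D where "\<forall>f\<in>S. \<bar>\<phi> f\<bar> \<le> C * N f" "\<forall>f\<in>S. \<bar>\<psi> f\<bar> \<le> D * N f"
      using \<phi> \<psi> by (auto simp: dual_space_def)
    then have "\<forall>f\<in>S. \<bar>(\<phi> + \<psi>) f\<bar> \<le> (C + D) * N f" by (fastforce simp: distrib_right)
    then have "\<exists>C. \<forall>f\<in>S. \<bar>(\<phi> + \<psi>) f\<bar> \<le> C * N f" by blast
    then show ?thesis using \<phi> \<psi> by (simp add: dual_space_def algebra_simps)
  qed
  show "fscale c \<phi> \<in> dual_space S N" if \<phi>: "\<phi> \<in> dual_space S N" for c \<phi>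
  proof -
    obtain C where "\<forall>f\<in>S. \<bar>\<phi> f\<bar> \<le> C * N f" using \<phi> by (auto simp: dual_space_def)
    then have "\<forall>f\<in>S. \<bar>fscale c \<phi> f\<bar> \<le> (\<bar>c\<bar> * C) * N f"
      by (auto simp: abs_mult mult.assoc intro: mult_left_mono)
    then have "\<exists>C. \<forall>f\<in>S. \<bar>fscale c \<phi> f\<bar> \<le> C * N f" by blast
    then show ?thesis using \<phi> by (simp add: dual_space_def algebra_simps)
  qed
qed

lemma dual_space_sum:
  assumes \<phi>: "\<phi> \<in> dual_space (Lip0 X b) N" and h: "\<And>i. i \<in> A \<Longrightarrow> h i \<in> Lip0 X b"
  shows "\<phi> (\<Sum>i\<in>A. h i) = (\<Sum>i\<in>A. \<phi> (h i))"
proof -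
  have add: "\<phi> (f + g) = \<phi> f + \<phi> g" if "f \<in> Lip0 X b" "g \<in> Lip0 X b" for f g
    using \<phi> that by (auto simp: dual_space_def)
  have "\<phi> 0 = 0" using add[OF Lip0_zero Lip0_zero] by simp
  with h show ?thesis
    by (induction A rule: infinite_finite_induct) (auto simp: add Lip0_sum)
qed

lemma bdd_above_dual:
  assumes "\<phi> \<in> dual_space (Lip0 X b) (lip_norm X)"
  shows "bdd_above ((\<lambda>f. \<bar>\<phi> f\<bar>) ` {f \<in> Lip0 X b. lip_norm X f \<le> 1})"
proof -
  obtain C where C: "\<forall>g\<in>Lip0 X b. \<bar>\<phi> g\<bar> \<le> C * lip_norm X g"
    using assms by (auto simp: dual_space_def)
  \<comment> \<open>The constant in \<open>dual_space\<close> may be negative, hence the absolute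
    value.\<close>
  have "\<bar>\<phi> h\<bar> \<le> \<bar>C\<bar>" if h: "h \<in> Lip0 X b" "lip_norm X h \<le> 1" for h
  proof -
    have "\<bar>\<phi> h\<bar> \<le> \<bar>C\<bar> * lip_norm X h"
      using bspec[OF C h(1)] mult_right_mono[OF abs_ge_self[of C] lip_norm_nonneg[OF h(1)]] by linarith
    also have "\<dots> \<le> \<bar>C\<bar> * 1" using h(2) by (intro mult_left_mono) auto
    finally show ?thesis by simp
  qed
  then show ?thesis by (auto intro!: bdd_aboveI[of _ "\<bar>C\<bar>"])
qed

lemma free_norm_nonneg:
  assumes "\<phi> \<in> dual_space (Lip0 X b) (lip_norm X)"
  shows "0 \<le> free_norm X b \<phi>"
proof -
  have "\<bar>\<phi> 0\<bar> \<le> free_norm X b \<phi>"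
    unfolding dual_norm_def by (rule cSUP_upper[OF _ bdd_above_dual[OF assms]])
      (simp add: Lip0_zero lip_norm_le)
  then show ?thesis by linarith
qed

lemma dual_norm_bound:
  assumes \<phi>: "\<phi> \<in> dual_space (Lip0 X b) (lip_norm X)" and f: "f \<in> Lip0 X b"
  shows "\<bar>\<phi> f\<bar> \<le> free_norm X b \<phi> * lip_norm X f"
proof -
  obtain C where C: "\<forall>g\<in>Lip0 X b. \<bar>\<phi> g\<bar> \<le> C * lip_norm X g"
    using \<phi> by (auto simp: dual_space_def)
  show ?thesis
  proof (cases "lip_norm X f = 0")
    case True
    \<comment> \<open>Normalizing \<open>f\<close> is impossible here, but the bound with
      \<open>C\<close> already forces \<open>\<phi> f = 0\<close>.\<close>
    then show ?thesis using bspec[OF C f] by simp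
  next
    case False
    then have pos: "lip_norm X f > 0" using lip_norm_nonneg[OF f] by simp
    define g where "g = fscale (1 / lip_norm X f) f"
    have g: "g \<in> Lip0 X b" unfolding g_def by (rule Lip0_scale[OF f])
    have "lip_norm X g \<le> 1"
      by (rule lip_norm_le) (use pos lip_norm_bound_scale[OF f, of _ _ "1 / lip_norm X f"] in \<open>auto simp: g_def\<close>)
    then have "\<bar>\<phi> g\<bar> \<le> free_norm X b \<phi>"
      unfolding dual_norm_def using g by (intro cSUP_upper bdd_above_dual[OF \<phi>]) auto
    moreover have "\<phi> g = 1 / lip_norm X f * \<phi> f"
      using \<phi> f unfolding g_def by (auto simp: dual_space_def)
    ultimately show ?thesis using pos by (simp add: abs_mult divide_le_eq)
  qed
qed

lemma free_norm_le:
  assumes "0 \<le> C" "\<And>f. f \<in> Lip0 X b \<Longrightarrow> \<bar>\<phi> f\<bar> \<le> C * lip_norm X f"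
  shows "free_norm X b \<phi> \<le> C"
  unfolding dual_norm_def
proof (rule cSUP_least)
  have "lip_norm X 0 \<le> 1" by (rule lip_norm_le) auto
  then have "0 \<in> {f \<in> Lip0 X b. lip_norm X f \<le> 1}" by (simp add: Lip0_zero)
  then show "{f \<in> Lip0 X b. lip_norm X f \<le> 1} \<noteq> {}" by (metis empty_iff)
  show "\<bar>\<phi> f\<bar> \<le> C" if "f \<in> {f \<in> Lip0 X b. lip_norm X f \<le> 1}" for f
    using assms(2)[of f] mult_left_mono[of "lip_norm X f" 1 C] assms(1) that by auto
qed

lemma evaluation_in_dual:
  assumes "b \<in> mspace X" "x \<in> mspace X"
  shows "evaluation X b x \<in> dual_space (Lip0 X b) (lip_norm X)"
proof -
  have "\<bar>f x\<bar> \<le> mdist X x b * lip_norm X f" if "f \<in> Lip0 X b" for f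
    using lip_norm_bound[OF that assms(2,1)] that by (auto simp: Lip0_def mult.commute)
  then show ?thesis
    by (auto simp: dual_space_def evaluation_def Lip0_add Lip0_scale)
qed

text \<open>The size of the symmetric difference of the sets of ancestors of \<open>u\<close> and \<open>v\<close> is their
  distance in the tree defined by the parent map \<open>p\<close>, so \<open>K\<close> and \<open>L\<close> are the Lipschitz constants
  of the identity from and to the tree distance. The rank \<open>rk\<close> excludes cycles of \<open>p\<close>.\<close>

locale rooted_metric =
  fixes X :: "'a metric" and b :: 'a and p :: "'a \<Rightarrow> 'a" and rk :: "'a \<Rightarrow> nat" and K L :: real
  assumes base_in: "b \<in> mspace X"
    and parent_in: "\<And>v. v \<in> mspace X \<Longrightarrow> p v \<in> mspace X"
    and parent_base: "p b = b"
    and rank_less: "\<And>v. v \<in> mspace X \<Longrightarrow> v \<noteq> b \<Longrightarrow> rk (p v) < rk v"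
    and parent_dist: "\<And>v. v \<in> mspace X \<Longrightarrow> mdist X v (p v) \<le> K"
    and ancestors_card: "\<And>u v. u \<in> mspace X \<Longrightarrow> v \<in> mspace X \<Longrightarrow>
      real (card (sym_diff (ancestors p b u) (ancestors p b v))) \<le> L * mdist X u v"
    and L0: "0 \<le> L"
    and countable: "countable (mspace X)" and infinite: "infinite (mspace X)"
begin

abbreviation anc :: "'a \<Rightarrow> 'a set" where "anc \<equiv> ancestors p b"

abbreviation dual :: "(('a \<Rightarrow> real) \<Rightarrow> real) set" where
  "dual \<equiv> dual_space (Lip0 X b) (lip_norm X)"

lemma K0: "0 \<le> K"
  using parent_dist[OF base_in] mdist_zero[OF base_in base_in] by (simp add: parent_base)

lemma anc_base: "anc b = {}"
  by (rule ancestors_root[of p, OF parent_base])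

lemma ancestors_bounded:
  assumes "v \<in> mspace X"
  shows "finite (anc v) \<and> anc v \<subseteq> mspace X \<and> (\<forall>a\<in>anc v. rk a \<le> rk v)"
  using assms
proof (induction "rk v" arbitrary: v rule: less_induct)
  case less
  show ?case
  proof (cases "v = b")
    case False
    have "finite (anc (p v)) \<and> anc (p v) \<subseteq> mspace X \<and> (\<forall>a\<in>anc (p v). rk a \<le> rk (p v))"
      using less rank_less False parent_in by blast
    then show ?thesis
      using rank_less[OF less.prems False] less.prems ancestors_step[OF False, of p] by fastforce
  qed (simp add: anc_base)
qed

text \<open>The indicator function of the descendants of \<open>a\<close>, cut off outside the space
  as \<open>Lip0\<close> requires.\<close>

definition chi :: "'a \<Rightarrow> 'a \<Rightarrow> real" where
  "chi a v = (if v \<in> mspace X \<and> a \<in> anc v then 1 else 0)"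

lemma chi_base: "chi a b = 0"
  by (simp add: chi_def anc_base)

text \<open>Passing from \<open>p v\<close> to \<open>v\<close> adds the ancestor \<open>v\<close>,
  which is new because the ancestors of \<open>p v\<close> have rank below that of
  \<open>v\<close>.\<close>

lemma chi_parent:
  assumes "v \<in> mspace X" "v \<noteq> b"
  shows "chi a v = (if a = v then 1 else 0) + chi a (p v)"
proof -
  have "v \<notin> anc (p v)"
    using ancestors_bounded[OF parent_in[OF assms(1)]] rank_less[OF assms] by force
  then show ?thesis
    using assms parent_in ancestors_step[OF assms(2), of p] by (auto simp: chi_def)
qed

text \<open>The sum counts the elements of \<open>A\<close> in the symmetric difference of the
  ancestor sets. The bound does not depend on \<open>A\<close>, so every signed sum of indicators is
  \<open>L\<close>-Lipschitz.\<close>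

lemma sum_chi_diff:
  assumes "finite A" "u \<in> mspace X" "v \<in> mspace X"
  shows "(\<Sum>a\<in>A. \<bar>chi a u - chi a v\<bar>) \<le> L * mdist X u v"
proof -
  let ?S = "sym_diff (anc u) (anc v)"
  have "(\<Sum>a\<in>A. \<bar>chi a u - chi a v\<bar>) = (\<Sum>a\<in>A. if a \<in> ?S then 1 else 0)"
    using assms(2,3) by (intro sum.cong) (auto simp: chi_def)
  also have "\<dots> = (\<Sum>a\<in>A \<inter> ?S. 1)" by (rule sum.inter_restrict[OF assms(1), symmetric])
  also have "\<dots> = real (card (A \<inter> ?S))" by simp
  also have "\<dots> \<le> real (card ?S)"
    using ancestors_bounded[OF assms(2)] ancestors_bounded[OF assms(3)] by (intro of_nat_mono card_mono) auto
  finally show ?thesis using ancestors_card[OF assms(2,3)] by linarith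
qed

lemma chi_Lip0: "chi a \<in> Lip0 X b"
proof (rule Lip0I[of _ _ L])
  show "\<bar>chi a u - chi a v\<bar> \<le> L * mdist X u v" if "u \<in> mspace X" "v \<in> mspace X" for u v
    using sum_chi_diff[OF _ that, of "{a}"] by simp
qed (auto simp: chi_def anc_base)

text \<open>The vertices other than \<open>b\<close> stand for the edges to their parents, and these
  index the coordinates.\<close>

definition enum :: "nat \<Rightarrow> 'a" where
  "enum = from_nat_into (mspace X - {b})"

lemma bij_enum: "bij_betw enum UNIV (mspace X - {b})"
  unfolding enum_def using countable infinite by (intro bij_betw_from_nat_into) auto

lemma enum_in: "enum n \<in> mspace X" "enum n \<noteq> b"
  using bij_enum by (auto simp: bij_betw_def)

lemma enum_eq: "enum n = enum m \<longleftrightarrow> n = m"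
  using bij_enum by (auto simp: bij_betw_def inj_def)

section \<open>The coordinate map into \<open>l1\<close>\<close>

definition coords :: "(('a \<Rightarrow> real) \<Rightarrow> real) \<Rightarrow> nat \<Rightarrow> real" where
  "coords \<phi> n = \<phi> (chi (enum n))"

text \<open>Test \<open>\<phi>\<close> on the sum of the first \<open>N\<close> indicators with the
  signs of the coordinates: its value is the partial sum of absolute values, and by
  \<open>sum_chi_diff\<close> its Lipschitz norm is at most \<open>L\<close> for every
  \<open>N\<close>.\<close>

lemma coords_l1:
  assumes \<phi>: "\<phi> \<in> dual"
  shows "coords \<phi> \<in> l1" "l1_norm (coords \<phi>) \<le> L * free_norm X b \<phi>"
proof -
  have bound: "(\<Sum>n<N. \<bar>coords \<phi> n\<bar>) \<le> L * free_norm X b \<phi>" for N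
  proof -
    define s where "s n = sgn (coords \<phi> n)" for n
    define f where "f = (\<Sum>n<N. fscale (s n) (chi (enum n)))"
    have f: "f \<in> Lip0 X b" unfolding f_def by (intro Lip0_sum Lip0_scale chi_Lip0)
    have "lip_norm X f \<le> L"
    proof (rule lip_norm_le[OF L0])
      fix u v assume uv: "u \<in> mspace X" "v \<in> mspace X"
      have "\<bar>f u - f v\<bar> = \<bar>\<Sum>n<N. s n * (chi (enum n) u - chi (enum n) v)\<bar>"
        by (simp add: f_def sum_real_fun_apply right_diff_distrib sum_subtractf)
      also have "\<dots> \<le> (\<Sum>n<N. \<bar>s n * (chi (enum n) u - chi (enum n) v)\<bar>)" by (rule sum_abs)
      also have "\<dots> \<le> (\<Sum>n<N. \<bar>chi (enum n) u - chi (enum n) v\<bar>)"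
        by (intro sum_mono) (auto simp: s_def sgn_if abs_mult)
      also have "\<dots> = (\<Sum>a\<in>enum ` {..<N}. \<bar>chi a u - chi a v\<bar>)"
        by (subst sum.reindex) (auto simp: inj_on_def enum_eq)
      also have "\<dots> \<le> L * mdist X u v" by (rule sum_chi_diff) (use uv in auto)
      finally show "\<bar>f u - f v\<bar> \<le> L * mdist X u v" .
    qed
    have "\<phi> f = (\<Sum>n<N. \<phi> (fscale (s n) (chi (enum n))))"
      unfolding f_def by (intro dual_space_sum[OF \<phi>] Lip0_scale chi_Lip0)
    also have "\<dots> = (\<Sum>n<N. \<bar>coords \<phi> n\<bar>)"
      using \<phi> chi_Lip0 by (intro sum.cong) (auto simp: dual_space_def coords_def s_def sgn_if)
    finally have "(\<Sum>n<N. \<bar>coords \<phi> n\<bar>) = \<phi> f" by simp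
    also have "\<phi> f \<le> free_norm X b \<phi> * lip_norm X f" using dual_norm_bound[OF \<phi> f] by linarith
    also have "\<dots> \<le> free_norm X b \<phi> * L"
      by (rule mult_left_mono[OF \<open>lip_norm X f \<le> L\<close> free_norm_nonneg[OF \<phi>]])
    finally show ?thesis by (simp add: mult.commute)
  qed
  have sm: "summable (\<lambda>n. \<bar>coords \<phi> n\<bar>)"
    by (rule summableI_nonneg_bounded[OF _ bound]) simp
  then show "coords \<phi> \<in> l1" by (simp add: l1_def)
  show "l1_norm (coords \<phi>) \<le> L * free_norm X b \<phi>"
    unfolding l1_norm_def by (rule suminf_le_const[OF sm bound])
qed

section \<open>The inverse map from \<open>l1\<close>\<close>

definition increment :: "('a \<Rightarrow> real) \<Rightarrow> nat \<Rightarrow> real" where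
  "increment f n = f (enum n) - f (p (enum n))"

lemma increment_bound: "f \<in> Lip0 X b \<Longrightarrow> \<bar>increment f n\<bar> \<le> K * lip_norm X f"
proof -
  assume f: "f \<in> Lip0 X b"
  have "\<bar>increment f n\<bar> \<le> lip_norm X f * mdist X (enum n) (p (enum n))"
    unfolding increment_def using lip_norm_bound[OF f] enum_in parent_in by blast
  also have "\<dots> \<le> lip_norm X f * K"
    using enum_in lip_norm_nonneg[OF f] by (intro mult_left_mono parent_dist) auto
  finally show ?thesis by (simp add: mult.commute)
qed

text \<open>Biorthogonality: the indicators of descendants are dual to the edge functionals.\<close>

lemma increment_chi: "increment (chi (enum m)) n = (if n = m then 1 else 0)"
  using chi_parent[OF enum_in, of "enum m" n] by (auto simp: increment_def enum_eq)

lemma pairing_bound: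
  assumes x: "summable (\<lambda>n. \<bar>x n\<bar>)" and f: "f \<in> Lip0 X b"
  shows "summable (\<lambda>n. x n * increment f n)"
    "\<bar>\<Sum>n. x n * increment f n\<bar> \<le> K * (\<Sum>n. \<bar>x n\<bar>) * lip_norm X f"
proof -
  have le: "\<bar>x n * increment f n\<bar> \<le> (K * lip_norm X f) * \<bar>x n\<bar>" for n
    using mult_left_mono[OF increment_bound[OF f, of n], of "\<bar>x n\<bar>"]
    by (simp add: abs_mult mult.commute)
  have s: "summable (\<lambda>n. (K * lip_norm X f) * \<bar>x n\<bar>)" by (intro summable_mult x)
  have a: "summable (\<lambda>n. \<bar>x n * increment f n\<bar>)"
    by (rule summable_comparison_test'[OF s, of 0]) (use le in auto)
  then show "summable (\<lambda>n. x n * increment f n)" by (rule summable_rabs_cancel)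
  have "\<bar>\<Sum>n. x n * increment f n\<bar> \<le> (\<Sum>n. \<bar>x n * increment f n\<bar>)" by (rule summable_rabs[OF a])
  also have "\<dots> \<le> (\<Sum>n. (K * lip_norm X f) * \<bar>x n\<bar>)" by (rule suminf_le[OF le a s])
  also have "\<dots> = K * (\<Sum>n. \<bar>x n\<bar>) * lip_norm X f" using suminf_mult[OF x] by simp
  finally show "\<bar>\<Sum>n. x n * increment f n\<bar> \<le> K * (\<Sum>n. \<bar>x n\<bar>) * lip_norm X f" .
qed

text \<open>The series of \<open>x n\<close> times \<delta>(\<open>enum n\<close>) -
  \<delta>(\<open>p (enum n)\<close>), extended by 0 off \<open>Lip0\<close> to respect the
  convention of \<open>dual_space\<close>.\<close>

definition synth :: "(nat \<Rightarrow> real) \<Rightarrow> ('a \<Rightarrow> real) \<Rightarrow> real" where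
  "synth x f = (if f \<in> Lip0 X b then \<Sum>n. x n * increment f n else 0)"

lemma synth_dual:
  assumes "x \<in> l1"
  shows "synth x \<in> dual"
proof -
  have x: "summable (\<lambda>n. \<bar>x n\<bar>)" using assms by (simp add: l1_def)
  note s = pairing_bound(1)[OF x]
  have "synth x (f + g) = synth x f + synth x g" if "f \<in> Lip0 X b" "g \<in> Lip0 X b" for f g
    using that suminf_add[OF s s, of f g]
    by (simp add: synth_def Lip0_add increment_def algebra_simps)
  moreover have "synth x (fscale c f) = c * synth x f" if "f \<in> Lip0 X b" for c f
    using that suminf_mult[OF s[OF that], of c]
    by (simp add: synth_def Lip0_scale increment_def algebra_simps)
  moreover have "\<exists>C. \<forall>f\<in>Lip0 X b. \<bar>synth x f\<bar> \<le> C * lip_norm X f"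
    using pairing_bound(2)[OF x] by (auto simp: synth_def)
  ultimately show ?thesis by (auto simp: dual_space_def synth_def)
qed

text \<open>Truncating the series gives a finite combination of evaluations, and the error is at
  most \<open>K\<close> times the tail of the \<open>l1\<close> norm.\<close>

lemma synth_free:
  assumes "x \<in> l1"
  shows "synth x \<in> free_space X b"
  unfolding free_space_def
proof (intro CollectI conjI allI impI synth_dual[OF assms])
  fix \<epsilon> :: real assume "\<epsilon> > 0"
  have x: "summable (\<lambda>n. \<bar>x n\<bar>)" using assms by (simp add: l1_def)
  \<comment> \<open>Dividing by \<open>K + 1\<close> also covers \<open>K = 0\<close> and leaves
    \<open>K * (\<epsilon> / (K + 1)) < \<epsilon>\<close>.\<close>
  have "\<epsilon> / (K + 1) > 0" using \<open>\<epsilon> > 0\<close> K0 by simp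
  from suminf_exist_split[OF this x]
  obtain N where N: "norm (\<Sum>n. \<bar>x (n + N)\<bar>) < \<epsilon> / (K + 1)" by blast
  have xN: "summable (\<lambda>n. \<bar>x (n + N)\<bar>)" using x by (subst summable_iff_shift)
  define \<psi> where "\<psi> = (\<Sum>n<N. fscale (x n)
    (evaluation X b (enum n) - evaluation X b (p (enum n))))"
  have \<psi>: "\<psi> \<in> fscale.span (evaluation X b ` mspace X)"
    unfolding \<psi>_def using enum_in parent_in
    by (intro fscale.span_sum fscale.span_scale fscale.span_diff fscale.span_base) auto
  have "\<bar>(synth x - \<psi>) f\<bar> \<le> (K * (\<Sum>n. \<bar>x (n + N)\<bar>)) * lip_norm X f" if f: "f \<in> Lip0 X b" for f
  proof -
    have "\<psi> f = (\<Sum>n<N. x n * increment f n)"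
      using f by (simp add: \<psi>_def sum_real_fun_apply evaluation_def increment_def)
    moreover have "synth x f = (\<Sum>n. x (n + N) * increment f (n + N)) + (\<Sum>n<N. x n * increment f n)"
      using f suminf_split_initial_segment[OF pairing_bound(1)[OF x f], of N]
      by (simp add: synth_def)
    ultimately have eq: "(synth x - \<psi>) f = (\<Sum>n. x (n + N) * increment f (n + N))" by simp
    have le: "\<bar>x (n + N) * increment f (n + N)\<bar> \<le> (K * lip_norm X f) * \<bar>x (n + N)\<bar>" for n
      using mult_left_mono[OF increment_bound[OF f, of "n + N"], of "\<bar>x (n + N)\<bar>"]
      by (simp add: abs_mult mult.commute)
    have s: "summable (\<lambda>n. (K * lip_norm X f) * \<bar>x (n + N)\<bar>)" by (intro summable_mult xN)
    have a: "summable (\<lambda>n. \<bar>x (n + N) * increment f (n + N)\<bar>)"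
      by (rule summable_comparison_test'[OF s, of 0]) (use le in auto)
    have "\<bar>\<Sum>n. x (n + N) * increment f (n + N)\<bar> \<le> (\<Sum>n. (K * lip_norm X f) * \<bar>x (n + N)\<bar>)"
      using summable_rabs[OF a] suminf_le[OF le a s] by linarith
    then show ?thesis using suminf_mult[OF xN, of "K * lip_norm X f"] eq
      by (simp add: algebra_simps)
  qed
  moreover have "0 \<le> K * (\<Sum>n. \<bar>x (n + N)\<bar>)" using K0 suminf_nonneg[OF xN] by simp
  ultimately have "free_norm X b (synth x - \<psi>) \<le> K * (\<Sum>n. \<bar>x (n + N)\<bar>)"
    by (intro free_norm_le)
  also have "\<dots> \<le> K * (\<epsilon> / (K + 1))" using N K0 by (intro mult_left_mono) auto
  also have "\<dots> < \<epsilon>" using K0 \<open>\<epsilon> > 0\<close> by (simp add: field_simps)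
  finally show "\<exists>\<psi>\<in>fscale.span (evaluation X b ` mspace X). free_norm X b (synth x - \<psi>) < \<epsilon>"
    using \<psi> by blast
qed

lemma coords_synth: "x \<in> l1 \<Longrightarrow> coords (synth x) = x"
proof
  fix m
  have "(\<lambda>n. x n * increment (chi (enum m)) n) = (\<lambda>n. if n = m then x n else 0)"
    by (auto simp: increment_chi)
  then show "coords (synth x) m = x m"
    using sums_unique[OF sums_single[of m x]] by (simp add: coords_def synth_def chi_Lip0)
qed

text \<open>Only the increments at the ancestors of \<open>v\<close> contribute, and they telescope.\<close>

lemma branch_sums:
  assumes "f b = 0" "v \<in> mspace X"
  shows "(\<lambda>n. chi (enum n) v * increment f n) sums f v"
  using assms(2)
proof (induction "rk v" arbitrary: v rule: less_induct)
  case less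
  show ?case
  proof (cases "v = b")
    case True
    then show ?thesis using assms(1) by (simp add: chi_base)
  next
    case False
    then obtain m where m: "v = enum m" using less.prems bij_enum by (auto simp: bij_betw_def)
    have "(\<lambda>n. if n = m then increment f n else 0) sums increment f m" by (rule sums_single)
    moreover have "(\<lambda>n. chi (enum n) (p v) * increment f n) sums f (p v)"
      using less rank_less[OF less.prems False] parent_in by blast
    ultimately have "(\<lambda>n. (if n = m then increment f n else 0) + chi (enum n) (p v) * increment f n)
        sums (increment f m + f (p v))" by (rule sums_add)
    moreover have "(if n = m then increment f n else 0) + chi (enum n) (p v) * increment f n
        = chi (enum n) v * increment f n" for n
      using chi_parent[OF less.prems False, of "enum n"] by (auto simp: m enum_eq distrib_right)
    ultimately show ?thesis by (simp add: increment_def m)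
  qed
qed

text \<open>By linearity it suffices to expand the evaluation at \<open>v\<close>, whose coordinates
  are \<open>chi (enum n) v\<close>; this is \<open>branch_sums\<close>.\<close>

lemma span_expansion:
  assumes "\<psi> \<in> fscale.span (evaluation X b ` mspace X)"
  shows "\<psi> \<in> dual \<and> (\<forall>f\<in>Lip0 X b. (\<lambda>n. coords \<psi> n * increment f n) sums \<psi> f)"
  using assms
proof (induction rule: fscale.span_induct_alt)
  case base
  then show ?case using fscale.subspace_0[OF subspace_dual_space] by (simp add: coords_def zero_fun_def)
next
  case (step c \<delta> \<psi>)
  then obtain v where v: "v \<in> mspace X" "\<delta> = evaluation X b v" by blast
  have "\<delta> \<in> dual" using v evaluation_in_dual[OF base_in] by simp
  then have "fscale c \<delta> + \<psi> \<in> dual"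
    using step by (intro fscale.subspace_add fscale.subspace_scale subspace_dual_space) auto
  moreover have "(\<lambda>n. coords (fscale c \<delta> + \<psi>) n * increment f n) sums (fscale c \<delta> + \<psi>) f"
    if f: "f \<in> Lip0 X b" for f
  proof -
    have "(\<lambda>n. c * (chi (enum n) v * increment f n)) sums (c * f v)"
      using f v by (intro sums_mult branch_sums) (auto simp: Lip0_def)
    from sums_add[OF this] step f
    have "(\<lambda>n. c * (chi (enum n) v * increment f n) + coords \<psi> n * increment f n)
        sums (c * f v + \<psi> f)" by blast
    then show ?thesis
      using f by (simp add: v coords_def evaluation_def chi_Lip0 algebra_simps)
  qed
  ultimately show ?case by blast
qed

lemma free_space_dual: "\<phi> \<in> free_space X b \<Longrightarrow> \<phi> \<in> dual"
  by (simp add: free_space_def)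

text \<open>On the span this is \<open>span_expansion\<close>. Both sides are bounded linear in
  \<open>\<phi>\<close> for the free norm, so the identity passes to the closure.\<close>

lemma synth_coords:
  assumes \<phi>: "\<phi> \<in> free_space X b"
  shows "synth (coords \<phi>) = \<phi>"
proof
  fix f
  note d = free_space_dual[OF \<phi>]
  show "synth (coords \<phi>) f = \<phi> f"
  proof (cases "f \<in> Lip0 X b")
    case False
    then show ?thesis using d by (auto simp: dual_space_def synth_def)
  next
    case f: True
    have "\<bar>\<phi> f - synth (coords \<phi>) f\<bar> \<le> 0 + e" if "e > 0" for e
    proof -
      \<comment> \<open>The summand 1 accounts for \<open>\<phi> - \<psi>\<close> itself, and
        \<open>K * L\<close> for its image under \<open>coords\<close> followed by
        \<open>synth\<close>.\<close>
      define B where "B = (1 + K * L) * lip_norm X f"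
      have B0: "B \<ge> 0" using K0 L0 lip_norm_nonneg[OF f] by (simp add: B_def)
      then have "e / (B + 1) > 0" using that by simp
      then obtain \<psi> where \<psi>: "\<psi> \<in> fscale.span (evaluation X b ` mspace X)"
        "free_norm X b (\<phi> - \<psi>) < e / (B + 1)"
        using \<phi> by (auto simp: free_space_def)
      note \<psi>d = span_expansion[OF \<psi>(1)]
      have diff: "\<phi> - \<psi> \<in> dual"
        using d \<psi>d by (intro fscale.subspace_diff subspace_dual_space) auto
      let ?r = "free_norm X b (\<phi> - \<psi>)"
      have sm: "summable (\<lambda>n. \<bar>coords \<eta> n\<bar>)" if "\<eta> \<in> dual" for \<eta>
        using coords_l1(1)[OF that] by (simp add: l1_def)
      have "synth (coords \<psi>) f = \<psi> f" using \<psi>d f by (simp add: synth_def sums_iff)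
      moreover have "synth (coords (\<phi> - \<psi>)) f = synth (coords \<phi>) f - synth (coords \<psi>) f"
        using suminf_diff[OF pairing_bound(1)[OF sm[OF d] f] pairing_bound(1)[OF sm f], of \<psi>] \<psi>d f
        by (simp add: synth_def coords_def left_diff_distrib)
      ultimately have "\<phi> f - synth (coords \<phi>) f = (\<phi> - \<psi>) f - synth (coords (\<phi> - \<psi>)) f" by simp
      moreover have "\<bar>(\<phi> - \<psi>) f\<bar> \<le> ?r * lip_norm X f" by (rule dual_norm_bound[OF diff f])
      moreover have "\<bar>synth (coords (\<phi> - \<psi>)) f\<bar> \<le> K * (L * ?r) * lip_norm X f"
      proof -
        have "\<bar>synth (coords (\<phi> - \<psi>)) f\<bar> \<le> K * l1_norm (coords (\<phi> - \<psi>)) * lip_norm X f"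
          using pairing_bound(2)[OF sm[OF diff] f] f by (simp add: synth_def l1_norm_def)
        also have "\<dots> \<le> K * (L * ?r) * lip_norm X f"
          using coords_l1(2)[OF diff] K0 lip_norm_nonneg[OF f]
          by (intro mult_right_mono mult_left_mono)
        finally show ?thesis .
      qed
      ultimately have "\<bar>\<phi> f - synth (coords \<phi>) f\<bar> \<le> ?r * lip_norm X f + K * (L * ?r) * lip_norm X f"
        by linarith
      also have "\<dots> = ?r * B" by (simp add: B_def algebra_simps)
      also have "\<dots> \<le> e / (B + 1) * B" using \<psi>(2) B0 by (intro mult_right_mono) auto
      also have "\<dots> \<le> e" using B0 that by (simp add: field_simps)
      finally show ?thesis by simp
    qed
    then show ?thesis using field_le_epsilon[of "\<bar>\<phi> f - synth (coords \<phi>) f\<bar>" 0] by simp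
  qed
qed

theorem free_space_isomorphic_l1:
  "banach_isomorphic (free_space X b) (free_norm X b) l1 l1_norm"
  unfolding banach_isomorphic_def
proof (intro exI[of _ coords] conjI ballI allI)
  show "bij_betw coords (free_space X b) l1"
    by (rule bij_betw_byWitness[where f' = synth])
       (use synth_coords coords_synth synth_free coords_l1(1) free_space_dual in auto)
  show "\<exists>C. \<forall>\<phi>\<in>free_space X b. l1_norm (coords \<phi>) \<le> C * free_norm X b \<phi>"
    using coords_l1(2) free_space_dual by blast
qed (auto simp: coords_def fun_eq_iff)

end

section \<open>Free spaces of countable quasi-trees\<close>

theorem theorem1p1:
  fixes V :: "'a set" and E :: "'a set set" and b :: 'a
  assumes "simplicial_quasi_tree TYPE('b) V E"
    and "countable V" and "infinite V"
    and "b \<in> V"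
  shows "banach_isomorphic
           (free_space (graph_metric V E) b) (free_norm (graph_metric V E) b)
           l1 l1_norm"
proof -
  have G: "connected_graph V E" using assms(1) by (simp add: simplicial_quasi_tree_def)
  interpret rooted_graph V E b by standard (fact G, fact assms(4))
  obtain W :: "'b set" and F g where T: "is_tree W F"
    and g: "quasi_isometric_embedding (graph_metric V E) (graph_metric W F) g"
    using assms(1) by (auto simp: simplicial_quasi_tree_def quasi_tree_def quasi_isometry_def)
  obtain D where D: "\<And>u v. u \<in> V \<Longrightarrow> v \<in> cluster u \<Longrightarrow> edge_dist V E u v \<le> D"
    using cluster_diameter[OF T g] by blast
  \<comment> \<open>A parent is at most one edge and one cluster diameter away, hence
    \<open>D + 1\<close>; an edge changes at most 3 ancestors.\<close>
  interpret rooted_metric "graph_metric V E" b parent rank "D + 1" 3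
  proof (unfold_locales, unfold mspace_graph_metric[OF G] mdist_graph_metric[OF G])
    show "edge_dist V E v (parent v) \<le> D + 1" if "v \<in> V" for v
      using dist_parent[OF D that] .
    show "real (card (sym_diff (ancestors parent b u) (ancestors parent b v)))
        \<le> 3 * edge_dist V E u v" if "u \<in> V" "v \<in> V" for u v
      using ancestors_dist[OF that] .
    show "parent v \<in> V" if "v \<in> V" for v using parent_V[OF that] .
    show "rank (parent v) < rank v" if "v \<in> V" "v \<noteq> b" for v using rank_parent[OF that] .
    show "parent b = b" by (rule parent_root)
    show "b \<in> V" "countable V" "infinite V" by (fact assms)+
    show "(0::real) \<le> 3" by simp
  qed
  show ?thesis by (rule free_space_isomorphic_l1)
qed

end
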